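(* Let $A=\sigma(R)\langle x_1,\dots,x_n\rangle$ be a skew $PBW$ extension of a ring $R$ with parameters $\sigma_i,\delta_i,c_{ij},d_{ij},a_{ij}^{(k)}$. Let $B$ be a ring with a ring homomorphism $\varphi:R\to B$ and elements $y_1,\dots,y_n\in B$ such that (i) $y_i\varphi(r)=\varphi(\sigma_i(r))y_i+\varphi(\delta_i(r))$ for every $1\le i\le n$ and $r\in R$; (ii) $y_jy_i=\varphi(c_{ij})y_iy_j+\varphi(a_{ij}^{(1)})y_1+\cdots+\varphi(a_{ij}^{(n)})y_n+\varphi(d_{ij})$ for all $1\le i<j\le n$. Then there exists a unique ring homomorphism $\widetilde{\varphi}:A\to B$ such that $\widetilde{\varphi}\iota=\varphi$ and $\widetilde{\varphi}(x_i)=y_i$ for all $1\le i\le n$, where $\iota:R\to A$ is the inclusion.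
   Context: Rings are associative with $1$ and ring homomorphisms preserve $1$. A $\sigma$-derivation of $R$ is an additive map $\delta:R\to R$ with $\delta(rs)=\sigma(r)\delta(s)+\delta(r)s$. A ring $A$ is a skew $PBW$ extension of $R$, written $A=\sigma(R)\langle x_1,\dots,x_n\rangle$, if: $R\subseteq A$ (as a subring); there are $x_1,\dots,x_n\in A$ such that $A$ is a free left $R$-module with basis $\mathrm{Mon}(A)=\{x_1^{\alpha_1}\cdots x_n^{\alpha_n}:(\alpha_1,\dots,\alpha_n)\in\mathbb{N}^n\}$ (with $x_1^0\cdots x_n^0=1$); for every $1\le i\le n$ and $r\in R\setminus\{0\}$ there is $c_{i,r}\in R\setminus\{0\}$ with $x_ir-c_{i,r}x_i\in R$; for all $1\le i,j\le n$ there is $c_{i,j}\in R\setminus\{0\}$ with $x_jx_i-c_{i,j}x_ix_j\in R+Rx_1+\cdots+Rx_n$. Parameters: for such $A$ there are unique injective ring endomorphisms $\sigma_i:R\to R$ and $\sigma_i$-derivations $\delta_i:R\to R$ with $x_ir=\sigma_i(r)x_i+\delta_i(r)$ for all $r\in R$, $1\le i\le n$, and unique elements $c_{ij},d_{ij},a_{ij}^{(k)}\in R$ ($1\le i<j\le n$, $1\le k\le n$) with $x_jx_i=c_{ij}x_ix_j+a_{ij}^{(1)}x_1+\cdots+a_{ij}^{(n)}x_n+d_{ij}$. These are called the parameters of $A$. *)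

theory Defs
  imports "HOL-Algebra.Algebra"
begin

text \<open>
  Noncommutative left modules are not covered by the library, so bases are spelled out for a ring
  \<open>A\<close> regarded as a left module over a subring \<open>R\<close>. A basis is an indexed family: in a skew
  PBW extension, different exponent vectors are meant to give independent monomials, which would
  not follow from a condition on the set of monomials (for instance, \<open>A = R\<close> and \<open>x\<^sub>1 = 1\<close>
  would satisfy such a condition).
\<close>

definition left_spanning :: "('a, 'm) ring_scheme \<Rightarrow> 'a set \<Rightarrow> 'i set \<Rightarrow> ('i \<Rightarrow> 'a) \<Rightarrow> bool"
  where "left_spanning A R I b \<longleftrightarrow>
    (\<forall>a \<in> carrier A. \<exists>F r. finite F \<and> F \<subseteq> I \<and> r \<in> F \<rightarrow> R \<and> a = (\<Oplus>\<^bsub>A\<^esub>i\<in>F. r i \<otimes>\<^bsub>A\<^esub> b i))"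

definition left_independent :: "('a, 'm) ring_scheme \<Rightarrow> 'a set \<Rightarrow> 'i set \<Rightarrow> ('i \<Rightarrow> 'a) \<Rightarrow> bool"
  where "left_independent A R I b \<longleftrightarrow>
    (\<forall>F r. finite F \<and> F \<subseteq> I \<and> r \<in> F \<rightarrow> R \<and> (\<Oplus>\<^bsub>A\<^esub>i\<in>F. r i \<otimes>\<^bsub>A\<^esub> b i) = \<zero>\<^bsub>A\<^esub>
      \<longrightarrow> (\<forall>i\<in>F. r i = \<zero>\<^bsub>A\<^esub>))"

definition left_basis :: "('a, 'm) ring_scheme \<Rightarrow> 'a set \<Rightarrow> 'i set \<Rightarrow> ('i \<Rightarrow> 'a) \<Rightarrow> bool"
  where "left_basis A R I b \<longleftrightarrow>
    b \<in> I \<rightarrow> carrier A \<and> left_spanning A R I b \<and> left_independent A R I b"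

definition exponents :: "nat \<Rightarrow> (nat \<Rightarrow> nat) set"
  where "exponents n = {1..n} \<rightarrow>\<^sub>E UNIV"

text \<open>The factors do not commute; \<open>monomial A x n \<alpha>\<close> is
  \<open>x 1 ^ \<alpha> 1 * x 2 ^ \<alpha> 2 * \<dots> * x n ^ \<alpha> n\<close> in this order.\<close>

primrec monomial :: "('a, 'm) ring_scheme \<Rightarrow> (nat \<Rightarrow> 'a) \<Rightarrow> nat \<Rightarrow> (nat \<Rightarrow> nat) \<Rightarrow> 'a"
  where
    "monomial A x 0 \<alpha> = \<one>\<^bsub>A\<^esub>"
  | "monomial A x (Suc k) \<alpha> = monomial A x k \<alpha> \<otimes>\<^bsub>A\<^esub> (x (Suc k) [^]\<^bsub>A\<^esub> \<alpha> (Suc k))"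

text \<open>The left \<open>R\<close>-submodule \<open>R + R x\<^sub>1 + \<dots> + R x\<^sub>n\<close>.\<close>

definition affine_forms :: "('a, 'm) ring_scheme \<Rightarrow> 'a set \<Rightarrow> nat \<Rightarrow> (nat \<Rightarrow> 'a) \<Rightarrow> 'a set"
  where "affine_forms A R n x =
    {s \<oplus>\<^bsub>A\<^esub> (\<Oplus>\<^bsub>A\<^esub>k\<in>{1..n}. r k \<otimes>\<^bsub>A\<^esub> x k) | s r. s \<in> R \<and> r \<in> {1..n} \<rightarrow> R}"

locale skew_PBW_extension = ring A
  for A :: "('a, 'm) ring_scheme" (structure)
    and R :: "'a set" and n :: nat and x :: "nat \<Rightarrow> 'a" +
  assumes subring_R: "subring R A"
    and x_closed: "x \<in> {1..n} \<rightarrow> carrier A"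
    and monomials_basis: "left_basis A R (exponents n) (monomial A x n)"
    and x_coeff: "\<lbrakk>i \<in> {1..n}; r \<in> R - {\<zero>}\<rbrakk>
      \<Longrightarrow> \<exists>c \<in> R - {\<zero>}. x i \<otimes> r \<ominus> c \<otimes> x i \<in> R"
    and x_x: "\<lbrakk>i \<in> {1..n}; j \<in> {1..n}\<rbrakk>
      \<Longrightarrow> \<exists>c \<in> R - {\<zero>}. x j \<otimes> x i \<ominus> c \<otimes> x i \<otimes> x j \<in> affine_forms A R n x"

definition skew_derivation :: "('a, 'm) ring_scheme \<Rightarrow> ('a \<Rightarrow> 'a) \<Rightarrow> ('a \<Rightarrow> 'a) \<Rightarrow> bool"
  where "skew_derivation S \<sigma> \<delta> \<longleftrightarrow>
    \<delta> \<in> carrier S \<rightarrow> carrier S \<and>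
    (\<forall>r \<in> carrier S. \<forall>s \<in> carrier S. \<delta> (r \<oplus>\<^bsub>S\<^esub> s) = \<delta> r \<oplus>\<^bsub>S\<^esub> \<delta> s) \<and>
    (\<forall>r \<in> carrier S. \<forall>s \<in> carrier S.
      \<delta> (r \<otimes>\<^bsub>S\<^esub> s) = \<sigma> r \<otimes>\<^bsub>S\<^esub> \<delta> s \<oplus>\<^bsub>S\<^esub> \<delta> r \<otimes>\<^bsub>S\<^esub> s)"

text \<open>
  \<open>c i j\<close>, \<open>d i j\<close> and \<open>a i j k\<close> stand for \<open>c\<^sub>i\<^sub>j\<close>, \<open>d\<^sub>i\<^sub>j\<close> and the coefficient of \<open>x\<^sub>k\<close>;
  only the values with \<open>i < j\<close> matter.
\<close>

locale skew_PBW_parameters = skew_PBW_extension A R n x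
  for A :: "('a, 'm) ring_scheme" (structure)
    and R :: "'a set" and n :: nat and x :: "nat \<Rightarrow> 'a" +
  fixes \<sigma> \<delta> :: "nat \<Rightarrow> 'a \<Rightarrow> 'a"
    and c d :: "nat \<Rightarrow> nat \<Rightarrow> 'a"
    and a :: "nat \<Rightarrow> nat \<Rightarrow> nat \<Rightarrow> 'a"
  assumes \<sigma>_hom: "i \<in> {1..n} \<Longrightarrow> \<sigma> i \<in> ring_hom (A\<lparr>carrier := R\<rparr>) (A\<lparr>carrier := R\<rparr>)"
    and \<sigma>_inj: "i \<in> {1..n} \<Longrightarrow> inj_on (\<sigma> i) R"
    and \<delta>_derivation: "i \<in> {1..n} \<Longrightarrow> skew_derivation (A\<lparr>carrier := R\<rparr>) (\<sigma> i) (\<delta> i)"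
    and x_mult_coeff: "\<lbrakk>i \<in> {1..n}; r \<in> R\<rbrakk> \<Longrightarrow> x i \<otimes> r = \<sigma> i r \<otimes> x i \<oplus> \<delta> i r"
    and c_closed: "\<lbrakk>1 \<le> i; i < j; j \<le> n\<rbrakk> \<Longrightarrow> c i j \<in> R"
    and d_closed: "\<lbrakk>1 \<le> i; i < j; j \<le> n\<rbrakk> \<Longrightarrow> d i j \<in> R"
    and a_closed: "\<lbrakk>1 \<le> i; i < j; j \<le> n; k \<in> {1..n}\<rbrakk> \<Longrightarrow> a i j k \<in> R"
    and x_mult_x: "\<lbrakk>1 \<le> i; i < j; j \<le> n\<rbrakk>
      \<Longrightarrow> x j \<otimes> x i = c i j \<otimes> x i \<otimes> x j \<oplus> (\<Oplus>k\<in>{1..n}. a i j k \<otimes> x k) \<oplus> d i j"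

end

theory Submission
  imports Defs
begin

text \<open>
  Let \<open>C = A \<times> B\<close>, let \<open>K\<close> be the graph of \<open>\<phi>\<close>, a subring of \<open>C\<close>, and let \<open>z i = (x i, y i)\<close>. By (i) and (ii)
  the \<open>z i\<close> satisfy over \<open>K\<close> the relations that make the left \<open>K\<close>-span \<open>G\<close> of the standard monomials
  closed under multiplication; this half of the PBW theorem is the reduction to normal form and needs
  no confluence. So \<open>G\<close> is a subring of \<open>A \<times> B\<close>. Its projection to \<open>A\<close> is onto
  because the monomials in \<open>x\<close> span \<open>A\<close>, and injective because they are independent. Hence \<open>G\<close> is
  the graph of a ring homomorphism, the required extension of \<open>\<phi>\<close>.
\<close>

section \<open>Left spans\<close>

text \<open>The same index may be added repeatedly, so linear arguments become inductions over one
  term \<open>k \<otimes> b i\<close> at a time, with no bookkeeping of supports.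
  \<open>left_span_imp_finsum\<close> recovers sums with distinct indices.\<close>

inductive_set left_span :: "('a, 'm) ring_scheme \<Rightarrow> 'a set \<Rightarrow> 'i set \<Rightarrow> ('i \<Rightarrow> 'a) \<Rightarrow> 'a set"
  for A :: "('a, 'm) ring_scheme" and K :: "'a set" and I :: "'i set" and b :: "'i \<Rightarrow> 'a"
  where
    zero: "\<zero>\<^bsub>A\<^esub> \<in> left_span A K I b"
  | add: "\<lbrakk>k \<in> K; i \<in> I; s \<in> left_span A K I b\<rbrakk> \<Longrightarrow> k \<otimes>\<^bsub>A\<^esub> b i \<oplus>\<^bsub>A\<^esub> s \<in> left_span A K I b"

lemma left_span_mono:
  assumes "I \<subseteq> J" "s \<in> left_span A K I b"
  shows "s \<in> left_span A K J b"
  using assms(2,1) by induction (auto intro: left_span.intros)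

context ring
begin

context
  fixes K :: "'a set" and I :: "'i set" and b :: "'i \<Rightarrow> 'a"
  assumes K: "subring K R" and b: "b \<in> I \<rightarrow> carrier R"
begin

lemma left_span_closed:
  assumes "s \<in> left_span R K I b"
  shows "s \<in> carrier R"
  using assms
  by (induction rule: left_span.induct) (use b subringE(1)[OF K] in \<open>auto simp: Pi_iff\<close>)

lemma left_span_add:
  assumes "s \<in> left_span R K I b" "t \<in> left_span R K I b"
  shows "s \<oplus> t \<in> left_span R K I b"
  using assms
proof (induction rule: left_span.induct)
  case zero
  then show ?case by (simp add: left_span_closed)
next
  case (add k i s)
  have "k \<otimes> b i \<oplus> s \<oplus> t = k \<otimes> b i \<oplus> (s \<oplus> t)"
    using add subringE(1)[OF K] b left_span_closed by (intro a_assoc) (auto simp: Pi_iff)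
  with add show ?case by (simp add: left_span.add)
qed

lemma left_span_smult:
  assumes "k \<in> K" "s \<in> left_span R K I b"
  shows "k \<otimes> s \<in> left_span R K I b"
  using assms(2)
proof (induction rule: left_span.induct)
  case zero
  have "k \<in> carrier R" using assms(1) subringE(1)[OF K] by auto
  then show ?case by (simp add: left_span.zero)
next
  case (add l i s)
  have "k \<otimes> (l \<otimes> b i \<oplus> s) = (k \<otimes> l) \<otimes> b i \<oplus> k \<otimes> s"
    using add assms(1) subringE(1)[OF K] b left_span_closed[of s]
    by (auto simp: Pi_iff r_distr m_assoc subset_iff)
  with add assms(1) subringE(6)[OF K] show ?case by (simp add: left_span.add)
qed

lemma left_span_uminus:
  assumes "s \<in> left_span R K I b"
  shows "\<ominus> s \<in> left_span R K I b"
  using left_span_smult[OF subringE(5)[OF K subringE(3)[OF K]] assms] left_span_closed[OF assms]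
  by (simp add: l_minus)

lemma left_span_base:
  assumes "i \<in> I"
  shows "b i \<in> left_span R K I b"
  using left_span.add[OF subringE(3)[OF K] assms left_span.zero, of R b] b assms
  by (auto simp: Pi_iff)

lemma left_span_finsum:
  assumes "f \<in> F \<rightarrow> left_span R K I b"
  shows "(\<Oplus>i\<in>F. f i) \<in> left_span R K I b"
  using assms
proof (induction F rule: infinite_finite_induct)
  case (insert i F)
  then have "f \<in> F \<rightarrow> carrier R" "f i \<in> carrier R"
    by (auto simp: Pi_iff left_span_closed)
  with insert show ?case by (simp add: left_span_add)
qed (simp_all add: left_span.zero)

lemma left_span_eq_carrier:
  assumes "left_spanning R K I b"
  shows "left_span R K I b = carrier R"
proof
  show "carrier R \<subseteq> left_span R K I b"
  proof
    fix s assume "s \<in> carrier R"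
    with assms obtain F r where "F \<subseteq> I" "r \<in> F \<rightarrow> K" "s = (\<Oplus>i\<in>F. r i \<otimes> b i)"
      unfolding left_spanning_def by blast
    then show "s \<in> left_span R K I b"
      by (auto intro!: left_span_finsum left_span_smult left_span_base)
  qed
qed (use left_span_closed in blast)

text \<open>Terms with equal index are merged by adding their coefficients. This is the form that
  \<open>left_independent\<close> speaks about, and it is used when the injectivity of the
  projection to \<open>A\<close> is shown.\<close>

lemma left_span_imp_finsum:
  assumes "s \<in> left_span R K I b"
  obtains F r where "finite F" "F \<subseteq> I" "r \<in> F \<rightarrow> K" "s = (\<Oplus>i\<in>F. r i \<otimes> b i)"
proof -
  have "\<exists>F r. finite F \<and> F \<subseteq> I \<and> r \<in> F \<rightarrow> K \<and> s = (\<Oplus>i\<in>F. r i \<otimes> b i)"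
    using assms
  proof (induction rule: left_span.induct)
    case zero
    show ?case by (rule exI[of _ "{}"]) simp
  next
    case (add k i s)
    then obtain F r where F: "finite F" "F \<subseteq> I" "r \<in> F \<rightarrow> K" "s = (\<Oplus>j\<in>F. r j \<otimes> b j)"
      by blast
    \<comment> \<open>The index \<open>i\<close> is split off from the old sum: \<open>l\<close> is
      its old coefficient, or zero if \<open>i\<close> did not occur. In both cases the new
      coefficient of \<open>i\<close> is \<open>k \<oplus> l\<close>.\<close>
    define F0 where "F0 = F - {i}"
    define l where "l = (if i \<in> F then r i else \<zero>)"
    define t where "t = (\<Oplus>j\<in>F0. r j \<otimes> b j)"
    have F0: "finite F0" "i \<notin> F0" "F0 \<subseteq> I" "r \<in> F0 \<rightarrow> K"
      using F by (auto simp: F0_def)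
    have l: "l \<in> K" using F(3) subringE(2)[OF K] by (auto simp: l_def)
    have cl: "k \<in> carrier R" "l \<in> carrier R" "b i \<in> carrier R"
      using add.hyps l subringE(1)[OF K] b by (auto simp: Pi_iff)
    have clF0: "(\<lambda>j. r j \<otimes> b j) \<in> F0 \<rightarrow> carrier R"
      using F0 b subringE(1)[OF K] by (auto simp: Pi_iff subset_iff)
    then have t: "t \<in> carrier R" unfolding t_def by (rule finsum_closed)
    have "s = l \<otimes> b i \<oplus> t"
    proof (cases "i \<in> F")
      case True
      then have "F = insert i F0" by (auto simp: F0_def)
      with True have "s = r i \<otimes> b i \<oplus> t"
        unfolding F(4) t_def
        using F0 clF0 cl by (simp add: l_def)
      with True show ?thesis by (simp add: l_def)
    next
      case False
      then have "F0 = F" by (auto simp: F0_def)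
      with False F(4) t cl show ?thesis by (simp add: l_def t_def)
    qed
    then have "k \<otimes> b i \<oplus> s = (k \<oplus> l) \<otimes> b i \<oplus> t"
      using cl t by (simp add: l_distr a_assoc)
    also have "\<dots> = (\<Oplus>j\<in>insert i F0. (r(i := k \<oplus> l)) j \<otimes> b j)"
    proof -
      have "t = (\<Oplus>j\<in>F0. (r(i := k \<oplus> l)) j \<otimes> b j)"
        unfolding t_def using F0(2) clF0 by (intro finsum_cong') auto
      moreover have "(\<lambda>j. (r(i := k \<oplus> l)) j \<otimes> b j) \<in> F0 \<rightarrow> carrier R"
        using clF0 F0(2) by (auto simp: Pi_iff)
      ultimately show ?thesis
        using F0(1,2) cl by (subst finsum_insert) auto
    qed
    finally have "k \<otimes> b i \<oplus> s = (\<Oplus>j\<in>insert i F0. (r(i := k \<oplus> l)) j \<otimes> b j)" .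
    moreover have "r(i := k \<oplus> l) \<in> insert i F0 \<rightarrow> K"
      using F0(4) add.hyps(1) l subringE(7)[OF K] by auto
    ultimately show ?case using F0 add.hyps(2)
      by (intro exI[of _ "insert i F0"] exI[of _ "r(i := k \<oplus> l)"]) auto
  qed
  then show thesis using that by blast
qed

end

text \<open>Moving \<open>z\<close> past a coefficient turns
  \<open>z \<otimes> (k \<otimes> b i)\<close> into
  \<open>l \<otimes> (z \<otimes> b i) \<oplus> m \<otimes> b i\<close>, so it suffices to know
  \<open>z \<otimes> b i\<close>. Two index sets are allowed because multiplication by a variable
  raises the degree bound; the term \<open>m \<otimes> b i\<close> requires
  \<open>I \<subseteq> J\<close>.\<close>

lemma lmult_left_span:
  assumes "subring K R" "b \<in> I \<rightarrow> carrier R" "b \<in> J \<rightarrow> carrier R" "I \<subseteq> J" "z \<in> carrier R"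
    and comm: "\<And>k. k \<in> K \<Longrightarrow> \<exists>l\<in>K. \<exists>m\<in>K. z \<otimes> k = l \<otimes> z \<oplus> m"
    and base: "\<And>i. i \<in> I \<Longrightarrow> z \<otimes> b i \<in> left_span R K J b"
    and "s \<in> left_span R K I b"
  shows "z \<otimes> s \<in> left_span R K J b"
  using assms(8)
proof (induction rule: left_span.induct)
  case zero
  then show ?case using assms by (simp add: left_span.zero)
next
  case (add k i s)
  obtain l m where lm: "l \<in> K" "m \<in> K" "z \<otimes> k = l \<otimes> z \<oplus> m"
    using comm[OF add.hyps(1)] by blast
  have cl: "k \<in> carrier R" "l \<in> carrier R" "m \<in> carrier R" "b i \<in> carrier R" "s \<in> carrier R"
    using assms add.hyps lm subringE(1)[OF assms(1)] left_span_closed[OF assms(1,2)]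
    by (auto simp: Pi_iff)
  have "z \<otimes> (k \<otimes> b i \<oplus> s) = (z \<otimes> k) \<otimes> b i \<oplus> z \<otimes> s"
    using cl assms(5) by (simp add: r_distr m_assoc)
  also have "\<dots> = l \<otimes> (z \<otimes> b i) \<oplus> m \<otimes> b i \<oplus> z \<otimes> s"
    unfolding lm(3) using cl assms(5) by (simp add: l_distr m_assoc)
  also have "\<dots> \<in> left_span R K J b"
  proof (intro left_span_add assms(1,3))
    show "l \<otimes> (z \<otimes> b i) \<in> left_span R K J b"
      using assms(1,3) lm(1) base[OF add.hyps(2)] by (rule left_span_smult)
    have "b i \<in> left_span R K J b"
      using assms(4) add.hyps(2) by (intro left_span_base assms(1,3)) auto
    then show "m \<otimes> b i \<in> left_span R K J b"
      by (rule left_span_smult[OF assms(1,3) lm(2)])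
  qed (rule add.IH)
  finally show ?case .
qed

section \<open>Monomials with ordered factors\<close>

lemma monomial_closed:
  assumes "x \<in> {1..n} \<rightarrow> carrier R" "k \<le> n"
  shows "monomial R x k \<alpha> \<in> carrier R"
  using assms(2) by (induction k) (use assms(1) in \<open>auto simp: Pi_iff\<close>)

lemma monomial_eq_one:
  "(\<And>i. i \<in> {1..k} \<Longrightarrow> \<alpha> i = 0) \<Longrightarrow> monomial R x k \<alpha> = \<one>"
  by (induction k) auto

text \<open>All factors before the power of \<open>x i\<close> are trivial, so \<open>x i\<close>
  meets that power directly and is absorbed without any commutation.\<close>

lemma monomial_Suc_exponent:
  assumes "x \<in> {1..n} \<rightarrow> carrier R" "k \<le> n" "1 \<le> i" "i \<le> k" "\<And>l. l \<in> {1..<i} \<Longrightarrow> \<alpha> l = 0"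
  shows "x i \<otimes> monomial R x k \<alpha> = monomial R x k (\<alpha>(i := Suc (\<alpha> i)))"
  using assms(2,4)
proof (induction k)
  case 0
  with assms(3) show ?case by simp
next
  case (Suc k)
  have x: "x i \<in> carrier R" "x (Suc k) \<in> carrier R"
    using assms(1,3) Suc.prems by (auto simp: Pi_iff)
  show ?case
  proof (cases "i = Suc k")
    case True
    define \<beta> where "\<beta> = \<alpha>(i := Suc (\<alpha> i))"
    \<comment> \<open>When \<open>x i\<close> is the last variable, the monomial is just its power.
      \<open>nat_pow_Suc2\<close> is needed because the new factor stands on the left, while powers
      recursively grow on the right.\<close>
    have one: "monomial R x k \<alpha> = \<one>" "monomial R x k \<beta> = \<one>"
      using True assms(5) by (auto simp: \<beta>_def intro!: monomial_eq_one)
    have "\<beta> (Suc k) = Suc (\<alpha> i)" using True by (simp add: \<beta>_def)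
    with True x one show ?thesis
      unfolding \<beta>_def[symmetric] using nat_pow_Suc2[of "x (Suc k)" "\<alpha> i"] by simp
  next
    case False
    with Suc x monomial_closed[OF assms(1), of k \<alpha>] show ?thesis
      by (simp flip: m_assoc)
  qed
qed

end

section \<open>Reduction to normal form\<close>

lemma fun_upd_in_exponents: "\<lbrakk>\<alpha> \<in> exponents n; 1 \<le> i; i \<le> n\<rbrakk> \<Longrightarrow> \<alpha>(i := k) \<in> exponents n"
  by (auto simp: exponents_def PiE_iff extensional_def)

lemma sum_fun_upd_Suc:
  fixes \<alpha> :: "'i \<Rightarrow> nat"
  assumes "finite S" "i \<in> S"
  shows "sum (\<alpha>(i := Suc (\<alpha> i))) S = Suc (sum \<alpha> S)"
proof -
  have "sum (\<alpha>(i := Suc (\<alpha> i))) (S - {i}) = sum \<alpha> (S - {i})"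
    by (rule sum.cong) auto
  then show ?thesis
    using sum.remove[OF assms, of \<alpha>] sum.remove[OF assms, of "\<alpha>(i := Suc (\<alpha> i))"] by simp
qed

text \<open>Only the rewriting rules of a skew PBW extension are kept, with existential
  coefficients. Thus the pairs \<open>(x i, y i)\<close> over the graph of \<open>\<phi>\<close>
  form an instance, whatever linear relations the \<open>y i\<close> satisfy in
  \<open>B\<close>.\<close>

locale pbw_relations = ring C
  for C :: "('a, 'm) ring_scheme" (structure)
    and K :: "'a set" and n :: nat and z :: "nat \<Rightarrow> 'a" +
  assumes subring_K: "subring K C"
    and z_closed: "z \<in> {1..n} \<rightarrow> carrier C"
    and z_coeff: "\<lbrakk>i \<in> {1..n}; r \<in> K\<rbrakk> \<Longrightarrow> \<exists>s\<in>K. \<exists>t\<in>K. z i \<otimes> r = s \<otimes> z i \<oplus> t"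
    and z_z: "\<lbrakk>1 \<le> i; i < j; j \<le> n\<rbrakk>
      \<Longrightarrow> \<exists>c\<in>K. \<exists>f\<in>affine_forms C K n z. z j \<otimes> z i = c \<otimes> z i \<otimes> z j \<oplus> f"
begin

text \<open>The bound on the total degree is the outer induction measure for reduction to normal
  form.\<close>

abbreviation bounded_exponents :: "nat \<Rightarrow> (nat \<Rightarrow> nat) set"
  where "bounded_exponents d \<equiv> {\<alpha> \<in> exponents n. sum \<alpha> {1..n} \<le> d}"

abbreviation normal_forms :: "'a set"
  where "normal_forms \<equiv> left_span C K (exponents n) (monomial C z n)"

abbreviation bounded_normal_forms :: "nat \<Rightarrow> 'a set"
  where "bounded_normal_forms d \<equiv> left_span C K (bounded_exponents d) (monomial C z n)"

lemma z_in_carrier: "\<lbrakk>1 \<le> i; i \<le> n\<rbrakk> \<Longrightarrow> z i \<in> carrier C"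
  using z_closed by auto

lemma monomials_closed: "monomial C z n \<in> J \<rightarrow> carrier C"
  using monomial_closed[OF z_closed] by auto

text \<open>Disposes of the error term left when two variables are interchanged: distributing over
  the affine form leaves only \<open>t\<close> and the products \<open>z i \<otimes> t\<close>, with
  coefficients from \<open>K\<close> on the left.\<close>

lemma affine_form_mult:
  assumes "f \<in> affine_forms C K n z" "t \<in> left_span C K J (monomial C z n)"
    and "\<And>i. \<lbrakk>1 \<le> i; i \<le> n\<rbrakk> \<Longrightarrow> z i \<otimes> t \<in> left_span C K J (monomial C z n)"
  shows "f \<otimes> t \<in> left_span C K J (monomial C z n)"
proof -
  from assms(1) obtain s r where f: "f = s \<oplus> (\<Oplus>k\<in>{1..n}. r k \<otimes> z k)" "s \<in> K" "r \<in> {1..n} \<rightarrow> K"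
    unfolding affine_forms_def by blast
  have t: "t \<in> carrier C"
    using left_span_closed[OF subring_K monomials_closed assms(2)] .
  have r: "r k \<in> carrier C" if "k \<in> {1..n}" for k
    using f(3) that subringE(1)[OF subring_K] by auto
  have s: "s \<in> carrier C" using f(2) subringE(1)[OF subring_K] by auto
  have cl: "(\<lambda>k. r k \<otimes> z k) \<in> {1..n} \<rightarrow> carrier C"
    using r z_in_carrier by auto
  have "f \<otimes> t = s \<otimes> t \<oplus> (\<Oplus>k\<in>{1..n}. r k \<otimes> z k \<otimes> t)"
    unfolding f(1) using s t cl by (simp add: l_distr finsum_ldistr)
  also have "(\<Oplus>k\<in>{1..n}. r k \<otimes> z k \<otimes> t) = (\<Oplus>k\<in>{1..n}. r k \<otimes> (z k \<otimes> t))"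
    using r t z_in_carrier by (intro finsum_cong') (auto simp: m_assoc)
  also have "s \<otimes> t \<oplus> \<dots> \<in> left_span C K J (monomial C z n)"
  proof (intro left_span_add left_span_finsum subring_K monomials_closed Pi_I)
    show "s \<otimes> t \<in> left_span C K J (monomial C z n)"
      using assms(2) f(2) by (intro left_span_smult subring_K monomials_closed)
    show "r k \<otimes> (z k \<otimes> t) \<in> left_span C K J (monomial C z n)" if "k \<in> {1..n}" for k
      using that assms(3)[of k] f(3) by (auto intro!: left_span_smult[OF subring_K monomials_closed, of "r k"])
  qed
  finally show ?thesis .
qed

lemma lmult_bounded_normal_forms:
  assumes i: "1 \<le> i" "i \<le> n"
    and "\<And>\<alpha>. \<alpha> \<in> bounded_exponents d
      \<Longrightarrow> z i \<otimes> monomial C z n \<alpha> \<in> bounded_normal_forms (Suc d)"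
    and "s \<in> bounded_normal_forms d"
  shows "z i \<otimes> s \<in> bounded_normal_forms (Suc d)"
proof (rule lmult_left_span[OF subring_K monomials_closed monomials_closed _
      z_in_carrier[OF i] z_coeff _ assms(4)])
qed (use assms in auto)

text \<open>
  Induction on \<open>(d, i)\<close> in lexicographic order: if \<open>z j\<close> is the first variable of a monomial \<open>z j m\<close>
  and \<open>j < i\<close>, then up to terms covered by the bound \<open>d\<close>, \<open>z i (z j m)\<close> is a multiple of
  \<open>z j (z i m)\<close>, where \<open>z i m\<close> is again covered by \<open>d\<close> and the outer index has dropped.
\<close>

lemma z_mult_monomial:
  assumes "\<alpha> \<in> bounded_exponents d" "1 \<le> i" "i \<le> n"
  shows "z i \<otimes> monomial C z n \<alpha> \<in> bounded_normal_forms (Suc d)"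
  using assms
proof (induction d arbitrary: i \<alpha>)
  case 0
  then have "\<alpha> l = 0" if "l \<in> {1..n}" for l using that by simp
  with 0 have eq: "z i \<otimes> monomial C z n \<alpha> = monomial C z n (\<alpha>(i := Suc (\<alpha> i)))"
    by (intro monomial_Suc_exponent[OF z_closed]) auto
  from 0 have "\<alpha>(i := Suc (\<alpha> i)) \<in> bounded_exponents (Suc 0)"
    using sum_fun_upd_Suc[of "{1..n}" i \<alpha>] by (simp add: fun_upd_in_exponents)
  then show ?case
    unfolding eq by (rule left_span_base[OF subring_K monomials_closed])
next
  case (Suc d)
  note outer = Suc.IH
  from Suc.prems show ?case
  proof (induction i arbitrary: \<alpha> rule: less_induct)
    case (less i)
    show ?case
    proof (cases "\<forall>l\<in>{1..<i}. \<alpha> l = 0")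
      case True
      with less.prems have eq: "z i \<otimes> monomial C z n \<alpha> = monomial C z n (\<alpha>(i := Suc (\<alpha> i)))"
        by (intro monomial_Suc_exponent[OF z_closed]) auto
      from less.prems have "\<alpha>(i := Suc (\<alpha> i)) \<in> bounded_exponents (Suc (Suc d))"
        by (simp add: fun_upd_in_exponents sum_fun_upd_Suc del: fun_upd_apply)
      then show ?thesis
        unfolding eq by (rule left_span_base[OF subring_K monomials_closed])
    next
      case False
      \<comment> \<open>\<open>z j\<close> is the first variable occurring in the monomial. Exponent
        vectors have an arbitrary default value outside \<open>{1..n}\<close>: the condition
        \<open>1 \<le> j\<close> excludes index 0, and \<open>j \<le> l\<close> with
        \<open>l < i\<close> keeps \<open>j\<close> at most \<open>n\<close>.\<close>
      define j where "j = (LEAST j. 1 \<le> j \<and> \<alpha> j \<noteq> 0)"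
      from False obtain l where l: "1 \<le> l" "l < i" "\<alpha> l \<noteq> 0" by auto
      then have j1: "1 \<le> j" "\<alpha> j \<noteq> 0"
        using LeastI[of "\<lambda>j. 1 \<le> j \<and> \<alpha> j \<noteq> 0" l] by (auto simp: j_def)
      have "j \<le> l" unfolding j_def using l by (intro Least_le) auto
      with l less.prems have ji: "j < i" "j \<le> n" by auto
      have below: "\<alpha> k = 0" if "k \<in> {1..<j}" for k
        using that not_less_Least[of k "\<lambda>j. 1 \<le> j \<and> \<alpha> j \<noteq> 0"] by (auto simp: j_def)
      \<comment> \<open>Removing one leading factor \<open>z j\<close> lowers the degree, so the
        outer induction hypothesis applies to \<open>m\<close> for every variable, in particular for
        those appearing in the error term.\<close>
      define \<beta> where "\<beta> = \<alpha>(j := \<alpha> j - 1)"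
      define m where "m = monomial C z n \<beta>"
      have \<alpha>: "\<alpha> = \<beta>(j := Suc (\<beta> j))" using j1 by (auto simp: \<beta>_def)
      have "z j \<otimes> m = monomial C z n (\<beta>(j := Suc (\<beta> j)))"
        unfolding m_def using j1(1) ji(2) below
        by (intro monomial_Suc_exponent[OF z_closed]) (auto simp: \<beta>_def)
      with \<alpha> have mon: "monomial C z n \<alpha> = z j \<otimes> m" by simp
      have \<beta>: "\<beta> \<in> bounded_exponents d"
        using less.prems(1) j1 ji sum_fun_upd_Suc[of "{1..n}" j \<beta>]
        by (simp add: \<beta>_def fun_upd_in_exponents flip: \<alpha>[unfolded \<beta>_def])
      have zm: "z k \<otimes> m \<in> bounded_normal_forms (Suc d)" if "1 \<le> k" "k \<le> n" for k
        unfolding m_def using outer[OF \<beta> that] .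
      have up: "s \<in> bounded_normal_forms (Suc (Suc d))" if "s \<in> bounded_normal_forms (Suc d)" for s
        using that by (rule left_span_mono[rotated]) auto
      have m: "m \<in> bounded_normal_forms (Suc (Suc d))"
        unfolding m_def using \<beta> by (intro left_span_base[OF subring_K monomials_closed]) auto
      \<comment> \<open>\<open>z i \<otimes> m\<close> is a combination of monomials of degree at
        most \<open>Suc d\<close>, not of smaller degree than \<open>\<alpha>\<close> is allowed;
        here the smaller index \<open>j < i\<close> makes the inner induction hypothesis applicable
        to each of them.\<close>
      have swap: "z j \<otimes> (z i \<otimes> m) \<in> bounded_normal_forms (Suc (Suc d))"
        using less.IH[OF ji(1) _ j1(1) ji(2)] zm[OF less.prems(2,3)]
        by (rule lmult_bounded_normal_forms[OF j1(1) ji(2)])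
      obtain c f where cf: "c \<in> K" "f \<in> affine_forms C K n z" "z i \<otimes> z j = c \<otimes> z j \<otimes> z i \<oplus> f"
        using z_z[OF j1(1) ji(1) less.prems(3)] by blast
      have cl: "c \<in> carrier C" "z i \<in> carrier C" "z j \<in> carrier C" "m \<in> carrier C"
        using cf(1) subringE(1)[OF subring_K] z_in_carrier less.prems j1(1) ji
          left_span_closed[OF subring_K monomials_closed m] by auto
      have "(\<lambda>k. r k \<otimes> z k) \<in> {1..n} \<rightarrow> carrier C" if "r \<in> {1..n} \<rightarrow> K" for r
        using that subringE(1)[OF subring_K] z_in_carrier by (auto simp: Pi_iff subset_iff)
      then have f: "f \<in> carrier C"
        using cf(2) subringE(1)[OF subring_K] by (auto simp: affine_forms_def)
      have "z i \<otimes> monomial C z n \<alpha> = (z i \<otimes> z j) \<otimes> m"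
        using cl by (simp add: mon m_assoc)
      also have "\<dots> = c \<otimes> (z j \<otimes> (z i \<otimes> m)) \<oplus> f \<otimes> m"
        unfolding cf(3) using cl f by (simp add: l_distr m_assoc)
      also have "\<dots> \<in> bounded_normal_forms (Suc (Suc d))"
        using left_span_smult[OF subring_K monomials_closed cf(1) swap]
          affine_form_mult[OF cf(2) m up[OF zm]]
        by (rule left_span_add[OF subring_K monomials_closed])
      finally show ?thesis .
    qed
  qed
qed

section \<open>The ring of normal forms\<close>

lemma z_mult_normal_form:
  assumes "1 \<le> i" "i \<le> n" "s \<in> normal_forms"
  shows "z i \<otimes> s \<in> normal_forms"
proof (rule lmult_left_span[OF subring_K monomials_closed monomials_closed order_refl
      z_in_carrier[OF assms(1,2)] z_coeff _ assms(3)])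
  fix \<alpha> assume "\<alpha> \<in> exponents n"
  then have "\<alpha> \<in> bounded_exponents (sum \<alpha> {1..n})" by simp
  from z_mult_monomial[OF this assms(1,2)] show "z i \<otimes> monomial C z n \<alpha> \<in> normal_forms"
    by (rule left_span_mono[rotated]) auto
qed (use assms in auto)

text \<open>The variables act from the right end of the monomial: the power of the last one is
  applied to \<open>s\<close> first, one factor at a time, and each step is covered by
  \<open>z_mult_normal_form\<close>.\<close>

lemma monomial_mult_normal_form:
  assumes "s \<in> normal_forms" "k \<le> n"
  shows "monomial C z k \<alpha> \<otimes> s \<in> normal_forms"
  using assms
proof (induction k arbitrary: s)
  case 0
  then show ?case using left_span_closed[OF subring_K monomials_closed] by simp
next
  case (Suc k)
  have z: "z (Suc k) \<in> carrier C" using Suc.prems z_in_carrier by auto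
  have s: "s \<in> carrier C" using Suc.prems left_span_closed[OF subring_K monomials_closed] by simp
  have "z (Suc k) [^] e \<otimes> t \<in> normal_forms" if "t \<in> normal_forms" for e :: nat and t
    using that
  proof (induction e arbitrary: t)
    case 0
    then show ?case using left_span_closed[OF subring_K monomials_closed] by simp
  next
    case (Suc e)
    then show ?case
      using z_mult_normal_form[of "Suc k" t] \<open>Suc k \<le> n\<close> z
        left_span_closed[OF subring_K monomials_closed Suc.prems]
      by (simp add: m_assoc)
  qed
  from Suc.IH[OF this[OF Suc.prems(1)]] Suc.prems z s monomial_closed[OF z_closed] show ?case
    by (simp add: m_assoc)
qed

lemma one_normal_form: "\<one> \<in> normal_forms"
proof -
  \<comment> \<open>The zero exponent vector has to be restricted to \<open>{1..n}\<close> since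
    members of \<open>exponents n\<close> are extensional.\<close>
  have eq: "monomial C z n (\<lambda>i\<in>{1..n}. 0) = \<one>" by (rule monomial_eq_one) auto
  have "(\<lambda>i\<in>{1..n}. 0) \<in> exponents n" by (auto simp: exponents_def)
  then show ?thesis
    unfolding eq[symmetric] by (rule left_span_base[OF subring_K monomials_closed])
qed

lemma coeff_normal_form: "r \<in> K \<Longrightarrow> r \<in> normal_forms"
  using left_span_smult[OF subring_K monomials_closed _ one_normal_form, of r]
    subringE(1)[OF subring_K] by auto

lemma z_normal_form: "\<lbrakk>1 \<le> i; i \<le> n\<rbrakk> \<Longrightarrow> z i \<in> normal_forms"
  using z_mult_normal_form[OF _ _ one_normal_form] z_in_carrier by force

text \<open>Coefficients of the left factor stand on the far left, so products reduce to a monomial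
  times a normal form followed by multiplication by elements of \<open>K\<close>.\<close>

theorem subring_normal_forms: "subring normal_forms C"
proof (rule subringI)
  show "normal_forms \<subseteq> carrier C"
    using left_span_closed[OF subring_K monomials_closed] by blast
  show "s \<otimes> t \<in> normal_forms" if "s \<in> normal_forms" "t \<in> normal_forms" for s t
    using that
  proof (induction rule: left_span.induct)
    case zero
    then show ?case
      using left_span_closed[OF subring_K monomials_closed] by (simp add: left_span.zero)
  next
    case (add k \<alpha> s)
    have "(k \<otimes> monomial C z n \<alpha> \<oplus> s) \<otimes> t = k \<otimes> (monomial C z n \<alpha> \<otimes> t) \<oplus> s \<otimes> t"
      using add.hyps add.prems left_span_closed[OF subring_K monomials_closed]
        subringE(1)[OF subring_K] monomial_closed[OF z_closed]
      by (simp add: l_distr m_assoc subset_iff)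
    with add show ?case
      by (auto intro!: left_span_add[OF subring_K monomials_closed]
          left_span_smult[OF subring_K monomials_closed] monomial_mult_normal_form)
  qed
qed (auto intro: one_normal_form left_span_uminus[OF subring_K monomials_closed]
    left_span_add[OF subring_K monomials_closed])

end

section \<open>Homomorphisms and direct products\<close>

lemma ring_hom_finsum:
  assumes "ring A" "ring B" "h \<in> ring_hom A B" "f \<in> F \<rightarrow> carrier A"
  shows "h (\<Oplus>\<^bsub>A\<^esub>i\<in>F. f i) = (\<Oplus>\<^bsub>B\<^esub>i\<in>F. h (f i))"
proof -
  interpret A: ring A by fact
  interpret B: ring B by fact
  note h = ring_hom_memE[OF assms(3)] ring_hom_zero[OF assms(3,1,2)]
  show ?thesis
    using assms(4)
  proof (induction F rule: infinite_finite_induct)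
    case (insert i F)
    then have "f \<in> F \<rightarrow> carrier A" "f i \<in> carrier A" "(\<lambda>i. h (f i)) \<in> F \<rightarrow> carrier B"
      using h(1) by auto
    with insert h show ?case by simp
  qed (use h in simp_all)
qed

lemma ring_hom_monomial:
  assumes "ring A" "ring B" "h \<in> ring_hom A B" "x \<in> {1..n} \<rightarrow> carrier A"
    and "\<And>i. i \<in> {1..n} \<Longrightarrow> h (x i) = y i" and "k \<le> n"
  shows "h (monomial A x k \<alpha>) = monomial B y k \<alpha>"
proof -
  interpret A: ring A by fact
  interpret B: ring B by fact
  note h = ring_hom_memE[OF assms(3)]
  have pow: "h (a [^]\<^bsub>A\<^esub> (e::nat)) = h a [^]\<^bsub>B\<^esub> e" if "a \<in> carrier A" for a e
    using that h by (induction e) auto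
  show ?thesis
    using assms(6)
  proof (induction k)
    case (Suc k)
    have "x (Suc k) \<in> carrier A" "monomial A x k \<alpha> \<in> carrier A"
      using Suc.prems assms(4) A.monomial_closed[OF assms(4)] by auto
    with Suc assms(5)[of "Suc k"] pow h show ?case by simp
  qed (use h in simp)
qed

text \<open>Supplies the uniqueness half of the universal property, with the monomials as
  \<open>b\<close>.\<close>

lemma ring_hom_eq_on_left_span:
  assumes "ring A" "subring K A" "b \<in> I \<rightarrow> carrier A" "ring B" "f \<in> ring_hom A B" "g \<in> ring_hom A B"
    and "\<And>k. k \<in> K \<Longrightarrow> f k = g k" "\<And>i. i \<in> I \<Longrightarrow> f (b i) = g (b i)"
    and "s \<in> left_span A K I b"
  shows "f s = g s"
proof -
  interpret A: ring A by fact
  note f = ring_hom_memE[OF assms(5)] and g = ring_hom_memE[OF assms(6)]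
  from assms(9) show ?thesis
  proof (induction rule: left_span.induct)
    case zero
    then show ?case
      using ring_hom_zero[OF assms(5,1,4)] ring_hom_zero[OF assms(6,1,4)] by simp
  next
    case (add k i s)
    then have "k \<in> carrier A" "b i \<in> carrier A" "s \<in> carrier A"
      using assms(3) subringE(1)[OF assms(2)] A.left_span_closed[OF assms(2,3)] by auto
    with add f g assms(7,8) show ?case by simp
  qed
qed

section \<open>Direct products and graphs of homomorphisms\<close>

lemma RDirProd_simps [simp]:
  "\<zero>\<^bsub>RDirProd A B\<^esub> = (\<zero>\<^bsub>A\<^esub>, \<zero>\<^bsub>B\<^esub>)"
  "\<one>\<^bsub>RDirProd A B\<^esub> = (\<one>\<^bsub>A\<^esub>, \<one>\<^bsub>B\<^esub>)"
  "(a, b) \<oplus>\<^bsub>RDirProd A B\<^esub> (a', b') = (a \<oplus>\<^bsub>A\<^esub> a', b \<oplus>\<^bsub>B\<^esub> b')"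
  "(a, b) \<otimes>\<^bsub>RDirProd A B\<^esub> (a', b') = (a \<otimes>\<^bsub>A\<^esub> a', b \<otimes>\<^bsub>B\<^esub> b')"
  by (simp_all add: RDirProd_def DirProd_def monoid.defs)

lemma fst_ring_hom: "fst \<in> ring_hom (RDirProd A B) A"
  by (auto simp: ring_hom_def RDirProd_carrier)

lemma snd_ring_hom: "snd \<in> ring_hom (RDirProd A B) B"
  by (auto simp: ring_hom_def RDirProd_carrier)

text \<open>Closure of \<open>G\<close> under the ring operations is exactly compatibility of the
  function it describes with them. The function is made extensional so that it is also unique as a
  HOL function.\<close>

lemma ring_hom_of_graph:
  assumes "subring G (RDirProd A B)" "ring A"
    and unique: "\<And>a. a \<in> carrier A \<Longrightarrow> \<exists>!b. (a, b) \<in> G"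
  obtains \<psi> where "\<psi> \<in> ring_hom A B" "\<psi> \<in> extensional (carrier A)"
    "\<And>a b. (a, b) \<in> G \<Longrightarrow> \<psi> a = b"
proof -
  interpret A: ring A by fact
  define \<psi> where "\<psi> = (\<lambda>a\<in>carrier A. THE b. (a, b) \<in> G)"
  note G = subringE[OF assms(1)]
  have carrier: "a \<in> carrier A \<and> b \<in> carrier B" if "(a, b) \<in> G" for a b
    using that G(1) by (auto simp: RDirProd_carrier)
  have eq: "\<psi> a = b" if "(a, b) \<in> G" for a b
    using that carrier[OF that] unique[of a] by (auto simp: \<psi>_def intro: the1_equality)
  have graph: "(a, \<psi> a) \<in> G" if "a \<in> carrier A" for a
    using theI'[OF unique[OF that]] that by (simp add: \<psi>_def)
  have "\<psi> \<in> ring_hom A B"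
  proof (rule ring_hom_memI)
    fix a a' assume a: "a \<in> carrier A" "a' \<in> carrier A"
    show "\<psi> a \<in> carrier B" using carrier[OF graph[OF a(1)]] by simp
    show "\<psi> (a \<otimes>\<^bsub>A\<^esub> a') = \<psi> a \<otimes>\<^bsub>B\<^esub> \<psi> a'"
      using G(6)[OF graph[OF a(1)] graph[OF a(2)]] by (intro eq) simp
    show "\<psi> (a \<oplus>\<^bsub>A\<^esub> a') = \<psi> a \<oplus>\<^bsub>B\<^esub> \<psi> a'"
      using G(7)[OF graph[OF a(1)] graph[OF a(2)]] by (intro eq) simp
  next
    show "\<psi> \<one>\<^bsub>A\<^esub> = \<one>\<^bsub>B\<^esub>" using G(3) by (intro eq) simp
  qed
  moreover have "\<psi> \<in> extensional (carrier A)" by (simp add: \<psi>_def)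
  ultimately show thesis using that eq by blast
qed

lemma subring_hom_graph:
  assumes "ring A" "ring B" "subring R A" "\<phi> \<in> ring_hom (A\<lparr>carrier := R\<rparr>) B"
  shows "subring ((\<lambda>r. (r, \<phi> r)) ` R) (RDirProd A B)"
proof -
  interpret A: ring A by fact
  interpret B: ring B by fact
  interpret C: ring "RDirProd A B" by (rule RDirProd_ring) fact+
  note R = subringE[OF assms(3)]
  have \<phi>: "\<phi> r \<in> carrier B" "\<phi> (r \<otimes>\<^bsub>A\<^esub> s) = \<phi> r \<otimes>\<^bsub>B\<^esub> \<phi> s" "\<phi> (r \<oplus>\<^bsub>A\<^esub> s) = \<phi> r \<oplus>\<^bsub>B\<^esub> \<phi> s"
    "\<phi> \<one>\<^bsub>A\<^esub> = \<one>\<^bsub>B\<^esub>" if "r \<in> R" "s \<in> R" for r s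
    using that ring_hom_memE[OF assms(4)] by auto
  have \<phi>0: "\<phi> \<zero>\<^bsub>A\<^esub> = \<zero>\<^bsub>B\<^esub>"
    using ring_hom_zero[OF assms(4) A.subring_is_ring[OF assms(3)] assms(2)] by simp
  have sub: "(\<lambda>r. (r, \<phi> r)) ` R \<subseteq> carrier (RDirProd A B)"
    using R(1) \<phi>(1) by (auto simp: RDirProd_carrier)
  show ?thesis
  proof (rule C.subringI[OF sub])
    show "\<one>\<^bsub>RDirProd A B\<^esub> \<in> (\<lambda>r. (r, \<phi> r)) ` R"
      using R(3) \<phi>(4)[OF R(3,3)] by (auto intro!: image_eqI)
    fix p assume "p \<in> (\<lambda>r. (r, \<phi> r)) ` R"
    then obtain r where r: "p = (r, \<phi> r)" "r \<in> R" by blast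
    have r': "\<ominus>\<^bsub>A\<^esub> r \<in> R" by (rule R(5)) fact
    have "r \<in> carrier A" using r R(1) by auto
    \<comment> \<open>The additive inverse in the product is identified by its defining equation,
      using \<open>\<phi>\<close> on \<open>\<ominus> r \<oplus> r\<close> and
      \<open>\<phi> \<zero> = \<zero>\<close>.\<close>
    then have "(\<ominus>\<^bsub>A\<^esub> r, \<phi> (\<ominus>\<^bsub>A\<^esub> r)) \<oplus>\<^bsub>RDirProd A B\<^esub> p = \<zero>\<^bsub>RDirProd A B\<^esub>"
      using \<phi>(3)[OF r' r(2)] \<phi>0 by (simp add: r(1) A.l_neg)
    then have "\<ominus>\<^bsub>RDirProd A B\<^esub> p = (\<ominus>\<^bsub>A\<^esub> r, \<phi> (\<ominus>\<^bsub>A\<^esub> r))"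
      using sub r r' by (intro C.minus_equality) auto
    then show "\<ominus>\<^bsub>RDirProd A B\<^esub> p \<in> (\<lambda>r. (r, \<phi> r)) ` R"
      using r' by auto
  next
    fix p q assume "p \<in> (\<lambda>r. (r, \<phi> r)) ` R" "q \<in> (\<lambda>r. (r, \<phi> r)) ` R"
    then obtain r s where "p = (r, \<phi> r)" "q = (s, \<phi> s)" "r \<in> R" "s \<in> R" by blast
    then show "p \<otimes>\<^bsub>RDirProd A B\<^esub> q \<in> (\<lambda>r. (r, \<phi> r)) ` R"
      "p \<oplus>\<^bsub>RDirProd A B\<^esub> q \<in> (\<lambda>r. (r, \<phi> r)) ` R"
      using R(6,7) \<phi>(2,3) by (auto intro!: image_eqI)
  qed
qed

section \<open>Universal property of a skew PBW extension\<close>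

theorem theorem3p1:
  fixes A :: "('a, 'm) ring_scheme" and B :: "('b, 'k) ring_scheme"
    and R :: "'a set" and n :: nat
    and x :: "nat \<Rightarrow> 'a" and y :: "nat \<Rightarrow> 'b"
    and \<sigma> \<delta> :: "nat \<Rightarrow> 'a \<Rightarrow> 'a"
    and c d :: "nat \<Rightarrow> nat \<Rightarrow> 'a"
    and a :: "nat \<Rightarrow> nat \<Rightarrow> nat \<Rightarrow> 'a"
    and \<phi> :: "'a \<Rightarrow> 'b"
  assumes "skew_PBW_extension A R n x"
    and "skew_PBW_parameters A R n x \<sigma> \<delta> c d a"
    and "ring B"
    and "\<phi> \<in> ring_hom (A\<lparr>carrier := R\<rparr>) B"
    and "y \<in> {1..n} \<rightarrow> carrier B"
    and "\<And>i r. \<lbrakk>i \<in> {1..n}; r \<in> R\<rbrakk>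
      \<Longrightarrow> y i \<otimes>\<^bsub>B\<^esub> \<phi> r = \<phi> (\<sigma> i r) \<otimes>\<^bsub>B\<^esub> y i \<oplus>\<^bsub>B\<^esub> \<phi> (\<delta> i r)"
    and "\<And>i j. \<lbrakk>1 \<le> i; i < j; j \<le> n\<rbrakk>
      \<Longrightarrow> y j \<otimes>\<^bsub>B\<^esub> y i = \<phi> (c i j) \<otimes>\<^bsub>B\<^esub> y i \<otimes>\<^bsub>B\<^esub> y j
            \<oplus>\<^bsub>B\<^esub> (\<Oplus>\<^bsub>B\<^esub>k\<in>{1..n}. \<phi> (a i j k) \<otimes>\<^bsub>B\<^esub> y k) \<oplus>\<^bsub>B\<^esub> \<phi> (d i j)"
  shows "\<exists>!\<psi>. \<psi> \<in> ring_hom A B \<and> \<psi> \<in> extensional (carrier A) \<and>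
      (\<forall>r\<in>R. \<psi> r = \<phi> r) \<and> (\<forall>i\<in>{1..n}. \<psi> (x i) = y i)"
proof -
  interpret A: skew_PBW_parameters A R n x \<sigma> \<delta> c d a by fact
  interpret B: ring B by fact
  define C where "C = RDirProd A B"
  define K where "K = (\<lambda>r. (r, \<phi> r)) ` R"
  define z where "z = (\<lambda>i. (x i, y i))"
  interpret C: ring C
    unfolding C_def using A.ring_axioms B.ring_axioms by (rule RDirProd_ring)
  note R = subringE[OF A.subring_R]
  note fst_hom = fst_ring_hom[of A B, folded C_def] and snd_hom = snd_ring_hom[of A B, folded C_def]
  have \<phi>_closed: "\<phi> r \<in> carrier B" if "r \<in> R" for r
    using ring_hom_memE(1)[OF assms(4)] that by auto
  have x: "x i \<in> carrier A" and y: "y i \<in> carrier B" if "i \<in> {1..n}" for i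
    using A.x_closed assms(5) that by auto
  have z: "z \<in> {1..n} \<rightarrow> carrier C"
    using x y by (auto simp: z_def C_def RDirProd_carrier)
  have K: "subring K C"
    unfolding K_def C_def
    using A.ring_axioms B.ring_axioms A.subring_R assms(4) by (rule subring_hom_graph)
  have R_carrier: "r \<in> carrier A" if "r \<in> R" for r
    using R(1) that by auto
  \<comment> \<open>The relations hold componentwise: in \<open>A\<close> by the choice of the
    parameters, in \<open>B\<close> by hypotheses (i) and (ii).\<close>
  interpret C: pbw_relations C K n z
  proof (intro pbw_relations.intro pbw_relations_axioms.intro C.ring_axioms K z)
    fix i p assume i: "i \<in> {1..n}" and "p \<in> K"
    then obtain r where r: "p = (r, \<phi> r)" "r \<in> R" by (auto simp: K_def)
    have "\<sigma> i r \<in> R" "\<delta> i r \<in> R"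
      using A.\<sigma>_hom[OF i] A.\<delta>_derivation[OF i] r(2)
      by (auto simp: ring_hom_def skew_derivation_def)
    moreover have "z i \<otimes>\<^bsub>C\<^esub> p = (\<sigma> i r, \<phi> (\<sigma> i r)) \<otimes>\<^bsub>C\<^esub> z i \<oplus>\<^bsub>C\<^esub> (\<delta> i r, \<phi> (\<delta> i r))"
      using A.x_mult_coeff[OF i r(2)] assms(6)[OF i r(2)] by (simp add: r(1) C_def z_def)
    ultimately show "\<exists>s\<in>K. \<exists>t\<in>K. z i \<otimes>\<^bsub>C\<^esub> p = s \<otimes>\<^bsub>C\<^esub> z i \<oplus>\<^bsub>C\<^esub> t"
      unfolding K_def by blast
  next
    fix i j :: nat assume ij: "1 \<le> i" "i < j" "j \<le> n"
    define w where "w = (\<Oplus>\<^bsub>C\<^esub>k\<in>{1..n}. (a i j k, \<phi> (a i j k)) \<otimes>\<^bsub>C\<^esub> z k)"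
    note cda = A.c_closed[OF ij] A.d_closed[OF ij] A.a_closed[OF ij]
    have terms: "(\<lambda>k. (a i j k, \<phi> (a i j k)) \<otimes>\<^bsub>C\<^esub> z k) \<in> {1..n} \<rightarrow> carrier C"
      using cda(3) x y R_carrier \<phi>_closed by (auto simp: C_def z_def RDirProd_carrier)
    \<comment> \<open>The projections are ring homomorphisms, so a finite sum in the product can be
      computed in each component.\<close>
    have w: "w = ((\<Oplus>\<^bsub>A\<^esub>k\<in>{1..n}. a i j k \<otimes>\<^bsub>A\<^esub> x k), (\<Oplus>\<^bsub>B\<^esub>k\<in>{1..n}. \<phi> (a i j k) \<otimes>\<^bsub>B\<^esub> y k))"
      using ring_hom_finsum[OF C.ring_axioms A.ring_axioms fst_hom terms]
        ring_hom_finsum[OF C.ring_axioms B.ring_axioms snd_hom terms]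
      unfolding w_def[symmetric] by (simp add: C_def z_def prod_eq_iff)
    have w_closed: "w \<in> carrier C" unfolding w_def using terms by (rule C.finsum_closed)
    have d_closed: "(d i j, \<phi> (d i j)) \<in> carrier C"
      using cda(2) R_carrier \<phi>_closed by (simp add: C_def RDirProd_carrier)
    have cz: "(c i j, \<phi> (c i j)) \<otimes>\<^bsub>C\<^esub> z i \<otimes>\<^bsub>C\<^esub> z j \<in> carrier C"
      using cda(1) R_carrier \<phi>_closed x y ij by (simp add: C_def z_def RDirProd_carrier)
    have "z j \<otimes>\<^bsub>C\<^esub> z i
        = (c i j, \<phi> (c i j)) \<otimes>\<^bsub>C\<^esub> z i \<otimes>\<^bsub>C\<^esub> z j \<oplus>\<^bsub>C\<^esub> w \<oplus>\<^bsub>C\<^esub> (d i j, \<phi> (d i j))"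
      unfolding w using A.x_mult_x[OF ij] assms(7)[OF ij] by (simp add: C_def z_def)
    \<comment> \<open>\<open>affine_forms\<close> puts the constant term first, whereas the defining
      relation puts it last.\<close>
    also have "\<dots> = (c i j, \<phi> (c i j)) \<otimes>\<^bsub>C\<^esub> z i \<otimes>\<^bsub>C\<^esub> z j \<oplus>\<^bsub>C\<^esub> ((d i j, \<phi> (d i j)) \<oplus>\<^bsub>C\<^esub> w)"
      using cz w_closed d_closed by (simp add: C.a_ac)
    finally have "z j \<otimes>\<^bsub>C\<^esub> z i = \<dots>" .
    moreover have "(d i j, \<phi> (d i j)) \<oplus>\<^bsub>C\<^esub> w \<in> affine_forms C K n z"
      unfolding affine_forms_def w_def
    proof (intro CollectI exI conjI)
      show "(d i j, \<phi> (d i j)) \<in> K" "(\<lambda>k. (a i j k, \<phi> (a i j k))) \<in> {1..n} \<rightarrow> K"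
        using cda(2,3) by (simp_all add: K_def)
    qed (rule refl)
    moreover have "(c i j, \<phi> (c i j)) \<in> K" using cda(1) by (simp add: K_def)
    ultimately show "\<exists>c\<in>K. \<exists>f\<in>affine_forms C K n z.
        z j \<otimes>\<^bsub>C\<^esub> z i = c \<otimes>\<^bsub>C\<^esub> z i \<otimes>\<^bsub>C\<^esub> z j \<oplus>\<^bsub>C\<^esub> f"
      by blast
  qed
  have mon: "fst (monomial C z n \<alpha>) = monomial A x n \<alpha>" for \<alpha>
    using ring_hom_monomial[OF C.ring_axioms A.ring_axioms fst_hom z, of x n] by (simp add: z_def)
  have mon_A: "monomial A x n \<in> exponents n \<rightarrow> carrier A"
    and indep: "left_independent A R (exponents n) (monomial A x n)"
    and span: "left_span A R (exponents n) (monomial A x n) = carrier A"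
    using A.monomials_basis A.left_span_eq_carrier[OF A.subring_R] by (auto simp: left_basis_def)
  \<comment> \<open>Each term \<open>k \<otimes> monomial A x n \<alpha>\<close> is lifted by
    replacing \<open>k\<close> with \<open>(k, \<phi> k)\<close> and \<open>x\<close> with
    \<open>z\<close>.\<close>
  have onto: "s \<in> fst ` C.normal_forms" if "s \<in> carrier A" for s
    using that[folded span]
  proof (induction rule: left_span.induct)
    case zero
    have "\<zero>\<^bsub>C\<^esub> \<in> C.normal_forms" by (rule left_span.zero)
    then show ?case by (force simp: C_def)
  next
    case (add k \<alpha> s)
    then obtain p where p: "p \<in> C.normal_forms" "s = fst p" by blast
    have "(k, \<phi> k) \<otimes>\<^bsub>C\<^esub> monomial C z n \<alpha> \<oplus>\<^bsub>C\<^esub> p \<in> C.normal_forms"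
      using add p by (intro left_span.add) (auto simp: K_def)
    moreover have fst_eq: "fst ((k, \<phi> k) \<otimes>\<^bsub>C\<^esub> q \<oplus>\<^bsub>C\<^esub> p) = k \<otimes>\<^bsub>A\<^esub> fst q \<oplus>\<^bsub>A\<^esub> fst p" for q
      by (cases p; cases q) (simp add: C_def)
    ultimately show ?case
      unfolding p(2) mon[symmetric] fst_eq[symmetric] by (intro imageI)
  qed
  \<comment> \<open>Independence of the monomials in \<open>A\<close> kills the first components of
    the coefficients. An element of \<open>K\<close> is determined by its first component, so the
    coefficients themselves vanish, and with them \<open>t\<close>.\<close>
  have kernel: "t = \<zero>\<^bsub>B\<^esub>" if t: "(\<zero>\<^bsub>A\<^esub>, t) \<in> C.normal_forms" for t
  proof -
    from t obtain F r where Fr: "finite F" "F \<subseteq> exponents n" "r \<in> F \<rightarrow> K"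
      "(\<zero>\<^bsub>A\<^esub>, t) = (\<Oplus>\<^bsub>C\<^esub>\<alpha>\<in>F. r \<alpha> \<otimes>\<^bsub>C\<^esub> monomial C z n \<alpha>)"
      by (rule C.left_span_imp_finsum[OF K C.monomials_closed])
    have cl: "r \<alpha> \<in> carrier C" "monomial C z n \<alpha> \<in> carrier C" if "\<alpha> \<in> F" for \<alpha>
      using Fr(3) that subringE(1)[OF K] C.monomial_closed[OF z] by auto
    have r_R: "(\<lambda>\<alpha>. fst (r \<alpha>)) \<in> F \<rightarrow> R"
      using Fr(3) by (force simp: K_def)
    have "\<zero>\<^bsub>A\<^esub> = (\<Oplus>\<^bsub>A\<^esub>\<alpha>\<in>F. fst (r \<alpha> \<otimes>\<^bsub>C\<^esub> monomial C z n \<alpha>))"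
      using ring_hom_finsum[OF C.ring_axioms A.ring_axioms fst_hom,
          of "\<lambda>\<alpha>. r \<alpha> \<otimes>\<^bsub>C\<^esub> monomial C z n \<alpha>" F] cl
      by (simp flip: Fr(4))
    also have "\<dots> = (\<Oplus>\<^bsub>A\<^esub>\<alpha>\<in>F. fst (r \<alpha>) \<otimes>\<^bsub>A\<^esub> monomial A x n \<alpha>)"
      using cl mon_A Fr(2) r_R R_carrier
      by (intro A.finsum_cong') (auto simp: ring_hom_mult[OF fst_hom] mon Pi_iff subset_iff)
    finally have "fst (r \<alpha>) = \<zero>\<^bsub>A\<^esub>" if "\<alpha> \<in> F" for \<alpha>
      using indep Fr(1,2) r_R that unfolding left_independent_def by metis
    moreover have "\<phi> \<zero>\<^bsub>A\<^esub> = \<zero>\<^bsub>B\<^esub>"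
      using ring_hom_zero[OF assms(4) A.subring_is_ring[OF A.subring_R] B.ring_axioms] by simp
    ultimately have "r \<alpha> = \<zero>\<^bsub>C\<^esub>" if "\<alpha> \<in> F" for \<alpha>
      using that Fr(3) by (force simp: K_def C_def)
    then have "(\<zero>\<^bsub>A\<^esub>, t) = (\<Oplus>\<^bsub>C\<^esub>\<alpha>\<in>F. \<zero>\<^bsub>C\<^esub>)"
      unfolding Fr(4) using cl(2) by (intro C.finsum_cong') auto
    then show ?thesis by (simp add: C_def[symmetric]) (simp add: C_def)
  qed
  have G_closed: "s \<in> carrier A \<and> t \<in> carrier B" if "(s, t) \<in> C.normal_forms" for s t
    using C.left_span_closed[OF K C.monomials_closed that] by (simp add: C_def RDirProd_carrier)
  have unique: "\<exists>!t. (s, t) \<in> C.normal_forms" if s: "s \<in> carrier A" for s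
  proof (rule ex_ex1I)
    show "\<exists>t. (s, t) \<in> C.normal_forms" using onto[OF s] by force
    fix t t' assume t: "(s, t) \<in> C.normal_forms" "(s, t') \<in> C.normal_forms"
    have "(\<ominus>\<^bsub>A\<^esub> s, \<ominus>\<^bsub>B\<^esub> t') \<in> carrier C"
      using G_closed[OF t(2)] by (simp add: C_def RDirProd_carrier)
    then have "\<ominus>\<^bsub>C\<^esub> (s, t') = (\<ominus>\<^bsub>A\<^esub> s, \<ominus>\<^bsub>B\<^esub> t')"
      using G_closed[OF t(2)]
      by (intro C.minus_equality) (auto simp: C_def RDirProd_carrier A.l_neg B.l_neg)
    \<comment> \<open>The difference of two elements over the same \<open>s\<close> has first
      component zero, so \<open>kernel\<close> applies to it.\<close>
    moreover have "(s, t) \<oplus>\<^bsub>C\<^esub> \<ominus>\<^bsub>C\<^esub> (s, t') \<in> C.normal_forms"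
      using subringE(5,7)[OF C.subring_normal_forms] t by blast
    ultimately have "t \<oplus>\<^bsub>B\<^esub> \<ominus>\<^bsub>B\<^esub> t' = \<zero>\<^bsub>B\<^esub>"
      using s by (intro kernel) (simp add: C_def A.r_neg)
    then show "t = t'"
      using G_closed[OF t(1)] G_closed[OF t(2)] by (metis B.minus_equality B.minus_minus B.a_inv_closed)
  qed
  obtain \<psi> where \<psi>: "\<psi> \<in> ring_hom A B" "\<psi> \<in> extensional (carrier A)"
    and graph: "\<And>s t. (s, t) \<in> C.normal_forms \<Longrightarrow> \<psi> s = t"
    using ring_hom_of_graph[OF C.subring_normal_forms[unfolded C_def] A.ring_axioms] unique
    unfolding C_def by blast
  have \<psi>_R: "\<psi> r = \<phi> r" if "r \<in> R" for r
    using that by (intro graph C.coeff_normal_form) (simp add: K_def)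
  have \<psi>_x: "\<psi> (x i) = y i" if "i \<in> {1..n}" for i
    using C.z_normal_form[of i] that by (intro graph) (simp add: z_def)
  show ?thesis
  proof (rule ex1I[of _ \<psi>])
    fix \<chi> assume \<chi>: "\<chi> \<in> ring_hom A B \<and> \<chi> \<in> extensional (carrier A) \<and>
      (\<forall>r\<in>R. \<chi> r = \<phi> r) \<and> (\<forall>i\<in>{1..n}. \<chi> (x i) = y i)"
    \<comment> \<open>The values on the \<open>x i\<close> fix the values on all monomials, hence on
      their span, which is \<open>carrier A\<close>; outside it, extensionality fixes them.\<close>
    have mon_B: "h (monomial A x n \<alpha>) = monomial B y n \<alpha>"
      if "h \<in> ring_hom A B" "\<forall>i\<in>{1..n}. h (x i) = y i" for h \<alpha>
      using that
      by (intro ring_hom_monomial[OF A.ring_axioms B.ring_axioms _ A.x_closed]) auto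
    have "\<chi> s = \<psi> s" if "s \<in> carrier A" for s
    proof (rule ring_hom_eq_on_left_span[OF A.ring_axioms A.subring_R mon_A B.ring_axioms])
      show "\<chi> (monomial A x n \<alpha>) = \<psi> (monomial A x n \<alpha>)" for \<alpha>
        using mon_B[of \<chi> \<alpha>] mon_B[of \<psi> \<alpha>] \<chi> \<psi>(1) \<psi>_x by simp
    qed (use \<chi> \<psi> \<psi>_R span that in auto)
    then show "\<chi> = \<psi>" using \<chi> \<psi>(2) by (auto intro: extensionalityI)
  qed (use \<psi> \<psi>_R \<psi>_x in auto)
qed

end
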